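(* Let $\Omega=\mathbb{T}$, let $N\in\mathbb{N}$, $T>0$, and suppose $V_x=0$. Let $\mathbf{x}=(x_1,\dots,x_N)\in C^1([0,T];\mathbb{R}^N)$ solve the $N$-particle variational problem described in the context, with $x_{i-1}(t)<x_i(t)$ for all $1\le i\le N$ and $t\in[0,T]$ (where $x_0=x_N-1$). If $U:[0,\infty)\to\mathbb{R}$ is convex, then the map $$t\mapsto \sum_{i=1}^{N} U(R_i(t))\,(x_i(t)-x_{i-1}(t))$$ is convex on $[0,T]$, where $R_i(t)=\dfrac{1/N}{x_i(t)-x_{i-1}(t)}$.
   Context: Standing data. $g\in C^1([0,\infty))$ is real-valued and non-decreasing, with $r\mapsto r g'(r)$ locally integrable near $0$. $G:(0,\infty)\to\mathbb{R}$ is a $C^1$ function (determined up to a constant) with $G'(r)=\frac{1}{r^2}\int_0^r s g'(s)\,ds$; $G$ is assumed convex. $L:\mathbb{R}\to\mathbb{R}$ is of class $C^2$, bounded below and uniformly convex: there is $\theta>0$ with $L(\lambda u+(1-\lambda)v)\le \lambda L(u)+(1-\lambda)L(v)-\theta\lambda(1-\lambda)(u-v)^2$ for all $u,v\in\mathbb{R}$, $\lambda\in[0,1]$. $V\in C^1(\mathbb{T}\times[0,T];\mathbb{R})$ is the potential, where $\mathbb{T}=\mathbb{R}/\mathbb{Z}$. Configuration space (periodic case). Particle positions on $\mathbb{T}$ are represented by ordered lifts in $\mathbb{R}$: $\mathcal{K}^N=\{(x_1,\dots,x_N)\in\mathbb{R}^N: x_1\le\dots\le x_N\le x_1+1\}$,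 with the convention $x_0=x_N-1$. The $N$-particle variational problem. Given $\mathbf{x}^0,\mathbf{x}^T\in\mathcal{K}^N$, minimize $$\widetilde{\mathcal J}(\mathbf{x},\dot{\mathbf{x}})=\frac1N\sum_{i=1}^N\int_0^T\Big[L(\dot x_i(s))+G\Big(\frac{1/N}{x_i(s)-x_{i-1}(s)}\Big)-V(x_i(s),s)\Big]ds$$ among absolutely continuous $\mathbf{x}:[0,T]\to\mathcal{K}^N$ with $\mathbf{x}(0)=\mathbf{x}^0$, $\mathbf{x}(T)=\mathbf{x}^T$. When $x_i(s)=x_{i-1}(s)$, the $G$-term is interpreted as $\lim_{r\to\infty}G(r)\in(-\infty,+\infty]$. A minimizer is called a solution. *)

theory Defs
  imports "HOL-Analysis.Analysis"
begin

text \<open>On sets with boundary, derivatives are relative to the set (one-sided at endpoints), so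
  that no assumption is made on the values of a function outside its domain.\<close>

definition C1_on ::
    "('a::real_normed_vector \<Rightarrow> 'b::real_normed_vector) \<Rightarrow> 'a set \<Rightarrow> bool" where
  "C1_on f S \<longleftrightarrow>
     (\<exists>f' :: 'a \<Rightarrow> ('a \<Rightarrow>\<^sub>L 'b).
        (\<forall>x\<in>S. (f has_derivative blinfun_apply (f' x)) (at x within S)) \<and> continuous_on S f')"

definition unif_convex :: "(real \<Rightarrow> real) \<Rightarrow> bool" where
  "unif_convex L \<longleftrightarrow>
     (\<exists>\<theta>>0. \<forall>u v. \<forall>c\<in>{0..1}.
        L (c * u + (1 - c) * v) \<le> c * L u + (1 - c) * L v - \<theta> * c * (1 - c) * (u - v)\<^sup>2)"

definition abs_cont_on :: "(real \<Rightarrow> real) \<Rightarrow> real set \<Rightarrow> bool" where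
  "abs_cont_on f S \<longleftrightarrow>
     (\<forall>\<epsilon>>0. \<exists>\<delta>>0. \<forall>(n::nat) a b.
        (\<forall>k<n. a k \<le> b k \<and> {a k..b k} \<subseteq> S) \<and>
        disjoint_family_on (\<lambda>k. {a k<..<b k}) {..<n} \<and>
        (\<Sum>k<n. b k - a k) < \<delta>
        \<longrightarrow> (\<Sum>k<n. \<bar>f (b k) - f (a k)\<bar>) < \<epsilon>)"

text \<open>A point of \<open>\<real>\<^sup>N\<close> is a function \<^typ>\<open>nat \<Rightarrow> real\<close> of which only the values at \<open>1, \<dots>, N\<close>
  matter.\<close>

definition config_space :: "nat \<Rightarrow> (nat \<Rightarrow> real) set" where
  "config_space N = {p. (\<forall>i\<in>{1..<N}. p i \<le> p (i + 1)) \<and> p N \<le> p 1 + 1}"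

text \<open>The gap \<open>p\<^sub>i - p\<^sub>i\<^sub>-\<^sub>1\<close>, with the periodic convention \<open>p\<^sub>0 = p\<^sub>N - 1\<close>; the value \<open>p 0\<close> is
  never used.\<close>

definition gap :: "nat \<Rightarrow> (nat \<Rightarrow> real) \<Rightarrow> nat \<Rightarrow> real" where
  "gap N p i = p i - (if i = 1 then p N - 1 else p (i - 1))"

definition particle_density :: "nat \<Rightarrow> (nat \<Rightarrow> real) \<Rightarrow> nat \<Rightarrow> real" where
  "particle_density N p i = (1 / real N) / gap N p i"

definition G_term :: "(real \<Rightarrow> real) \<Rightarrow> nat \<Rightarrow> (nat \<Rightarrow> real) \<Rightarrow> nat \<Rightarrow> ereal" where
  "G_term G N p i =
     (if gap N p i = 0 then Lim at_top (\<lambda>r. ereal (G r)) else ereal (G (particle_density N p i)))"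

text \<open>Lebesgue integral of an extended-real function, as the integral of its positive part minus
  that of its negative part. It is used below only for integrands that are bounded below on a
  bounded interval, where it takes values in \<open>(-\<infinity>, \<infinity>]\<close>.\<close>

definition ereal_integral :: "'a measure \<Rightarrow> ('a \<Rightarrow> ereal) \<Rightarrow> ereal" where
  "ereal_integral M f =
     enn2ereal (\<integral>\<^sup>+s. e2ennreal (f s) \<partial>M) - enn2ereal (\<integral>\<^sup>+s. e2ennreal (- f s) \<partial>M)"

text \<open>For an absolutely continuous curve, the derivative exists almost everywhere; the value of
  \<^const>\<open>deriv\<close> on the exceptional null set (including the endpoints) is irrelevant.\<close>

definition action ::
    "(real \<Rightarrow> real) \<Rightarrow> (real \<Rightarrow> real) \<Rightarrow> (real \<Rightarrow> real \<Rightarrow> real) \<Rightarrow> nat \<Rightarrow> real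
      \<Rightarrow> (real \<Rightarrow> nat \<Rightarrow> real) \<Rightarrow> ereal" where
  "action L G V N T x =
     ereal (1 / real N) * (\<Sum>i=1..N. ereal_integral (lebesgue_on {0..T})
        (\<lambda>s. ereal (L (deriv (\<lambda>r. x r i) s)) + G_term G N (x s) i - ereal (V (x s i) s)))"

definition admissible ::
    "nat \<Rightarrow> real \<Rightarrow> (nat \<Rightarrow> real) \<Rightarrow> (nat \<Rightarrow> real) \<Rightarrow> (real \<Rightarrow> nat \<Rightarrow> real) \<Rightarrow> bool" where
  "admissible N T p q x \<longleftrightarrow>
     (\<forall>i\<in>{1..N}. abs_cont_on (\<lambda>t. x t i) {0..T} \<and> x 0 i = p i \<and> x T i = q i) \<and>
     (\<forall>t\<in>{0..T}. x t \<in> config_space N)"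

definition is_solution ::
    "(real \<Rightarrow> real) \<Rightarrow> (real \<Rightarrow> real) \<Rightarrow> (real \<Rightarrow> real \<Rightarrow> real) \<Rightarrow> nat \<Rightarrow> real
      \<Rightarrow> (nat \<Rightarrow> real) \<Rightarrow> (nat \<Rightarrow> real) \<Rightarrow> (real \<Rightarrow> nat \<Rightarrow> real) \<Rightarrow> bool" where
  "is_solution L G V N T p q x \<longleftrightarrow>
     admissible N T p q x \<and>
     (\<forall>y. admissible N T p q y \<longrightarrow> action L G V N T x \<le> action L G V N T y)"

end

theory Submission
  imports Defs
begin

text \<open>Write \<open>d\<^sub>i = x\<^sub>i - x\<^sub>i\<^sub>-\<^sub>1\<close>. As a function of the gaps, the interaction energy \<open>G (1 / (N d))\<close> has the
  nondecreasing derivative \<open>\<Gamma> d = - G' (1 / (N d)) / (N d\<^sup>2)\<close>, because \<open>G'\<close> is nonnegative and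
  nondecreasing. Since \<open>V\<close> does not depend on the position, the Euler--Lagrange equations are
  \<open>(L' (x\<^sub>i'))' = \<Gamma> d\<^sub>i - \<Gamma> d\<^sub>i\<^sub>+\<^sub>1\<close>. The functional is \<open>\<Sum>\<^sub>i h d\<^sub>i\<close> with \<open>h d = U (1 / (N d)) d\<close> convex. Formally
  its second derivative is at least \<open>\<Sum>\<^sub>i h' d\<^sub>i d\<^sub>i'' = \<Sum>\<^sub>i (h' d\<^sub>i - h' d\<^sub>i\<^sub>+\<^sub>1) x\<^sub>i''\<close>, and each term is nonnegative:
  \<open>h'\<close> and \<open>\<Gamma>\<close> are both nondecreasing, and \<open>x\<^sub>i''\<close> has the sign of \<open>\<Gamma> d\<^sub>i - \<Gamma> d\<^sub>i\<^sub>+\<^sub>1\<close>. As \<open>U\<close> need not be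
  differentiable, \<open>h'\<close> is replaced by a subgradient and the second derivative by a symmetric second
  difference, which has to be bounded below by \<open>- e r\<^sup>2\<close> for every \<open>e > 0\<close> as the step \<open>r\<close> tends to 0.\<close>

section \<open>Convexity from second differences\<close>

text \<open>If \<open>f\<close> exceeded a chord, adding a small convex parabola vanishing at the
  chord ends would leave the excess with a positive interior maximum. There the second difference is
  at most 0, whereas the parabola makes it positive.\<close>

lemma convex_on_second_difference:
  fixes f :: "real \<Rightarrow> real"
  assumes cont: "continuous_on {a..b} f"
    and sd: "\<And>t e. t \<in> {a<..<b} \<Longrightarrow> e > 0 \<Longrightarrow>
               \<forall>\<^sub>F h in at_right 0. - e * h\<^sup>2 \<le> f (t + h) + f (t - h) - 2 * f t"
  shows "convex_on {a..b} f"
proof (rule convex_on_linorderI)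
  fix t x y :: real
  assume t: "0 < t" "t < 1" and xy: "x \<in> {a..b}" "y \<in> {a..b}" "x < y"
  define c where "c = (1 - t) * x + t * y"
  have c1: "c - x = t * (y - x)" and c2: "y - c = (1 - t) * (y - x)"
    by (simp_all add: c_def algebra_simps)
  have "c - x > 0" "y - c > 0" unfolding c1 c2 using t xy by simp_all
  hence xc: "x < c" "c < y" by simp_all
  define \<sigma> where "\<sigma> = (f y - f x) / (y - x)"
  define l where "l s = f x + \<sigma> * (s - x)" for s
  have lc: "l c = (1 - t) * f x + t * f y"
    unfolding l_def c1 \<sigma>_def using xy(3) by simp (simp add: algebra_simps)
  have "f c \<le> l c"
  proof (rule ccontr)
    assume "\<not> f c \<le> l c"
    define D where "D = (c - x) * (y - c)"
    have D: "D > 0" using xc by (simp add: D_def)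
    \<comment> \<open>With this choice the parabola takes away exactly half of the excess at
      \<open>c\<close>, so \<open>F c\<close> stays positive.\<close>
    define e where "e = (f c - l c) / (2 * D)"
    have e: "e > 0" using \<open>\<not> f c \<le> l c\<close> D by (simp add: e_def)
    have eD: "e * D < f c - l c"
      using \<open>\<not> f c \<le> l c\<close> D by (simp add: e_def)
    define F where "F s = f s - l s + e * ((s - x) * (s - y))" for s
    have "F c = f c - l c - e * D" by (simp add: F_def D_def algebra_simps)
    with eD have Fc: "F c > 0" by simp
    have Fxy: "F x = 0" "F y = 0" using xy by (auto simp: F_def l_def \<sigma>_def)
    have "continuous_on {x..y} F"
      unfolding F_def l_def
      by (intro continuous_intros continuous_on_subset[OF cont]) (use xy in auto)
    then obtain z where z: "z \<in> {x..y}" and max: "\<And>s. s \<in> {x..y} \<Longrightarrow> F s \<le> F z"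
      using continuous_attains_sup[of "{x..y}" F] xy by auto
    have "F z > 0" using max[of c] Fc xc by auto
    hence z': "x < z" "z < y" using Fxy z by (auto simp: less_le)
    have "\<forall>\<^sub>F h in at_right 0. - e * h\<^sup>2 \<le> f (z + h) + f (z - h) - 2 * f z"
      by (rule sd) (use z' xy e in auto)
    moreover have "\<forall>\<^sub>F h in at_right 0. h \<in> {0<..<min (z - x) (y - z)}"
      by (rule eventually_at_right_real) (use z' in auto)
    ultimately have "\<forall>\<^sub>F h in at_right (0::real). False"
    proof eventually_elim
      case (elim h)
      \<comment> \<open>The affine part drops out and the parabola adds
        \<open>2 * e * h\<^sup>2\<close>, twice the deficit allowed by \<open>sd\<close>.\<close>
      have "l (z + h) + l (z - h) = 2 * l z" by (simp add: l_def algebra_simps)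
      hence "F (z + h) + F (z - h) - 2 * F z
              = f (z + h) + f (z - h) - 2 * f z + 2 * e * h\<^sup>2"
        by (simp add: F_def algebra_simps power2_eq_square)
      moreover have "e * h\<^sup>2 > 0" using e elim by auto
      ultimately have "F (z + h) + F (z - h) - 2 * F z > 0" using elim(1) by simp
      moreover have "F (z + h) \<le> F z" "F (z - h) \<le> F z" using elim by (auto intro!: max)
      ultimately show False by linarith
    qed
    thus False by (simp add: trivial_limit_at_right_real)
  qed
  thus "f ((1 - t) *\<^sub>R x + t *\<^sub>R y) \<le> (1 - t) * f x + t * f y"
    unfolding lc by (simp add: c_def)
qed simp

text \<open>The derivative in \<open>r\<close> of \<open>x (t + r) + x (t - r)\<close> is
  \<open>v (t + r) - v (t - r)\<close>; adding \<open>e * r\<^sup>2\<close> therefore makes the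
  second difference nondecreasing for small \<open>r\<close>, starting from 0.\<close>

lemma second_difference_ge:
  fixes x v :: "real \<Rightarrow> real"
  assumes deriv: "\<And>s. s \<in> {a..b} \<Longrightarrow> (x has_real_derivative v s) (at s within {a..b})"
    and t: "t \<in> {a<..<b}"
    and ev: "\<forall>\<^sub>F r in at_right 0. - 2 * e * r \<le> v (t + r) - v (t - r)"
  shows "\<forall>\<^sub>F r in at_right 0. - e * r\<^sup>2 \<le> x (t + r) + x (t - r) - 2 * x t"
proof -
  have D: "(x has_real_derivative v s) (at s)" if "s \<in> {a<..<b}" for s
    using deriv[of s] that at_within_interior[of s "{a..b}"] by auto
  have "\<forall>\<^sub>F h in at_right 0. h \<in> {0<..<min (t - a) (b - t)}"
    by (rule eventually_at_right_real) (use t in auto)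
  with ev have "\<forall>\<^sub>F r in at_right 0. - 2 * e * r \<le> v (t + r) - v (t - r) \<and> r < min (t - a) (b - t)"
    by eventually_elim auto
  then obtain d where d: "d > 0"
    "\<And>r. 0 < r \<Longrightarrow> r < d \<Longrightarrow> - 2 * e * r \<le> v (t + r) - v (t - r) \<and> r < min (t - a) (b - t)"
    by (auto simp: eventually_at_right_field)
  define f where "f r = x (t + r) + x (t - r) - 2 * x t + e * r\<^sup>2" for r
  have f0: "f r \<ge> 0" if r: "0 < r" "r < d" for r
  proof -
    have der: "(f has_real_derivative v (t + s) - v (t - s) + 2 * e * s) (at s)"
      if s: "0 \<le> s" "s \<le> r" for s
    proof -
      have m: "t + s \<in> {a<..<b}" "t - s \<in> {a<..<b}" using d(2)[OF r] s t by auto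
      have "((\<lambda>s. x (t + s)) has_real_derivative v (t + s) * 1) (at s)"
        by (rule DERIV_chain2[where f = x and g = "\<lambda>s. t + s", OF D[OF m(1)]]) (auto intro!: derivative_eq_intros)
      moreover have "((\<lambda>s. x (t - s)) has_real_derivative v (t - s) * (-1)) (at s)"
        by (rule DERIV_chain2[where f = x and g = "\<lambda>s. t - s", OF D[OF m(2)]]) (auto intro!: derivative_eq_intros)
      ultimately show ?thesis
        unfolding f_def by (auto intro!: derivative_eq_intros)
    qed
    have "f 0 \<le> f r"
    proof (rule DERIV_nonneg_imp_increasing_open[of 0 r f])
      show "\<exists>y. (f has_real_derivative y) (at s) \<and> 0 \<le> y" if "0 < s" "s < r" for s
        using der[of s] d(2)[of s] that r by fastforce
      show "continuous_on {0..r} f"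
        by (rule DERIV_atLeastAtMost_imp_continuous_on) (use der in blast)
    qed (use r in simp)
    thus ?thesis by (simp add: f_def)
  qed
  hence "- e * r\<^sup>2 \<le> x (t + r) + x (t - r) - 2 * x t" if "0 < r" "r < d" for r
    using f0[OF that] by (simp add: f_def)
  thus ?thesis using d(1) unfolding eventually_at_right_field by blast
qed

section \<open>Strong monotonicity of \<open>L'\<close> and velocity increments\<close>

text \<open>Uniform convexity means that \<open>L u - \<theta> * u\<^sup>2\<close> is convex; its
  tangent inequalities at \<open>u\<close> and at \<open>v\<close> add up to the claim with
  \<open>\<kappa> = 2 * \<theta>\<close>.\<close>

lemma unif_convex_strongly_mono_deriv:
  assumes L: "unif_convex L" and D: "\<And>u. (L has_real_derivative L' u) (at u)"
  obtains \<kappa> where "\<kappa> > 0" "\<And>u v. \<kappa> * (u - v)\<^sup>2 \<le> (L' u - L' v) * (u - v)"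
proof -
  from L obtain \<theta> where th: "\<theta> > 0" and
    c: "\<And>u v c. c \<in> {0..1} \<Longrightarrow>
        L (c * u + (1 - c) * v) \<le> c * L u + (1 - c) * L v - \<theta> * c * (1 - c) * (u - v)\<^sup>2"
    unfolding unif_convex_def by blast
  have conv: "convex_on UNIV (\<lambda>u. L u - \<theta> * u\<^sup>2)"
  proof (rule convex_onI)
    fix t x y :: real assume "0 < t" "t < 1"
    have "L ((1 - t) * x + t * y) \<le> (1 - t) * L x + t * L y - \<theta> * (1 - t) * t * (x - y)\<^sup>2"
      using c[of "1 - t" x y] \<open>0 < t\<close> \<open>t < 1\<close> by simp
    also have "\<theta> * (1 - t) * t * (x - y)\<^sup>2
         = (1 - t) * (\<theta> * x\<^sup>2) + t * (\<theta> * y\<^sup>2) - \<theta> * ((1 - t) * x + t * y)\<^sup>2"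
      by (simp add: algebra_simps power2_eq_square)
    finally show "L ((1 - t) *\<^sub>R x + t *\<^sub>R y) - \<theta> * ((1 - t) *\<^sub>R x + t *\<^sub>R y)\<^sup>2
          \<le> (1 - t) * (L x - \<theta> * x\<^sup>2) + t * (L y - \<theta> * y\<^sup>2)"
      by (simp add: algebra_simps)
  qed simp
  have tan: "(L' v - \<theta> * (2 * v)) * (u - v) \<le> (L u - \<theta> * u\<^sup>2) - (L v - \<theta> * v\<^sup>2)" for u v
    by (rule convex_on_imp_above_tangent[OF conv])
       (auto intro!: derivative_eq_intros D)
  show ?thesis
  proof (rule that[of "2 * \<theta>"])
    show "2 * \<theta> * (u - v)\<^sup>2 \<le> (L' u - L' v) * (u - v)" for u v
      using tan[of v u] tan[of u v] by (simp add: algebra_simps power2_eq_square)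
  qed (use th in simp)
qed

text \<open>Strong monotonicity of \<open>L'\<close> transfers the sign of the momentum change \<open>k\<close> to the velocity,
  so that no second derivative of \<open>L\<close> or of the trajectories is needed.\<close>

lemma velocity_difference_ge:
  fixes v k L' :: "real \<Rightarrow> real"
  assumes mom: "\<And>s. s \<in> {a..b} \<Longrightarrow> ((\<lambda>s. L' (v s)) has_real_derivative k s) (at s within {a..b})"
    and k: "continuous_on {a..b} k" and t: "t \<in> {a<..<b}" and wk: "0 \<le> w * k t"
    and kap: "\<kappa> > 0" "\<And>x y. \<kappa> * (x - y)\<^sup>2 \<le> (L' x - L' y) * (x - y)"
    and e: "e > 0"
  shows "\<forall>\<^sub>F r in at_right 0. - 2 * e * r \<le> w * v (t + r) - w * v (t - r)"
proof -
  have D: "((\<lambda>s. L' (v s)) has_real_derivative k s) (at s)" if "s \<in> {a<..<b}" for s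
    using mom[of s] that at_within_interior[of s "{a..b}"] by auto
  have "isCont k t" using k t by (auto intro: continuous_on_interior)
  hence "isCont (\<lambda>s. w * k s) t" by (intro continuous_intros)
  \<comment> \<open>The sign of \<open>w * k\<close> is known only at \<open>t\<close>; giving up
    \<open>\<kappa> * e\<close> makes the bound strict, so it persists nearby by continuity.\<close>
  moreover have "- (\<kappa> * e) < w * k t" using wk kap(1) e by (smt (verit) mult_pos_pos)
  ultimately have "\<forall>\<^sub>F s in at t. - (\<kappa> * e) < w * k s"
    unfolding isCont_def by (rule order_tendstoD)
  then obtain d where d: "d > 0" "\<And>s. s \<noteq> t \<Longrightarrow> \<bar>s - t\<bar> < d \<Longrightarrow> - (\<kappa> * e) < w * k s"
    by (auto simp: eventually_at dist_real_def)
  have dk: "- (\<kappa> * e) < w * k s" if "\<bar>s - t\<bar> < d" for s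
    using d(2)[of s] that \<open>- (\<kappa> * e) < w * k t\<close> by (cases "s = t") auto
  have "\<forall>\<^sub>F h in at_right 0. h \<in> {0<..<min d (min (t - a) (b - t))}"
    by (rule eventually_at_right_real) (use t d in auto)
  thus ?thesis
  proof eventually_elim
    case (elim r)
    define A where "A = L' (v (t + r)) - L' (v (t - r))"
    define D where "D = v (t + r) - v (t - r)"
    have "\<exists>z>t - r. z < t + r \<and> A = (t + r - (t - r)) * k z"
      unfolding A_def by (rule MVT2) (use elim in \<open>auto intro!: D\<close>)
    then obtain z where z: "z > t - r" "z < t + r" "A = 2 * r * k z" by auto
    have "- (\<kappa> * e) < w * k z" by (rule dk) (use z elim in auto)
    hence "2 * r * (- (\<kappa> * e)) \<le> 2 * r * (w * k z)"
      using elim by (intro mult_left_mono) auto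
    hence wA: "- 2 * \<kappa> * e * r \<le> w * A" by (simp add: z(3) algebra_simps)
    have AD: "\<kappa> * D\<^sup>2 \<le> A * D" unfolding A_def D_def by (rule kap)
    \<comment> \<open>Only \<open>w * D < 0\<close> needs work: multiplying \<open>AD\<close> by
      this negative number reverses it, and cancelling \<open>D\<^sup>2\<close> gives
      \<open>w * A \<le> \<kappa> * (w * D)\<close>.\<close>
    have "- 2 * e * r \<le> w * D"
    proof (cases "w * D < 0")
      case True
      hence D0: "D\<^sup>2 > 0" by auto
      have "(w * D) * (A * D) \<le> (w * D) * (\<kappa> * D\<^sup>2)"
        using AD True by (intro mult_left_mono_neg) auto
      hence "(w * A) * D\<^sup>2 \<le> (\<kappa> * (w * D)) * D\<^sup>2"
        by (simp add: algebra_simps power2_eq_square)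
      hence "w * A \<le> \<kappa> * (w * D)" using D0 by (rule mult_right_le_imp_le)
      hence "\<kappa> * (- 2 * e * r) \<le> \<kappa> * (w * D)" using wA by (simp add: algebra_simps)
      thus ?thesis using kap(1) by (rule mult_left_le_imp_le)
    next
      case False
      have "0 \<le> 2 * e * r" using e elim by auto
      with False show ?thesis by linarith
    qed
    thus ?case by (simp add: D_def algebra_simps)
  qed
qed

section \<open>Perspectives and subgradients of convex functions\<close>

text \<open>This is the perspective of \<open>U\<close>: \<open>c / d\<close> is a convex
  combination of \<open>c / x\<close> and \<open>c / y\<close>, and multiplying by \<open>d\<close>
  turns its weights back into those of \<open>d\<close> itself.\<close>

lemma convex_on_perspective:
  fixes U :: "real \<Rightarrow> real"
  assumes U: "convex_on {0..} U" and c: "c \<ge> 0"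
  shows "convex_on {0<..} (\<lambda>d. U (c / d) * d)"
proof (rule convex_onI)
  fix t x y :: real assume t: "0 < t" "t < 1" and xy: "x \<in> {0<..}" "y \<in> {0<..}"
  define d where "d = (1 - t) * x + t * y"
  have d: "d > 0" using t xy by (auto simp: d_def intro!: add_pos_pos)
  \<comment> \<open>The weight is the share of \<open>t * y\<close> in \<open>d\<close>, chosen so
    that \<open>(1 - l) * (c / x) + l * (c / y) = c / d\<close>.\<close>
  define l where "l = t * y / d"
  have ld: "l * d = t * y" "(1 - l) * d = (1 - t) * x" using d by (simp_all add: l_def d_def field_simps)
  have l: "0 \<le> l" using t xy d by (auto simp: l_def)
  have l2: "1 - l = (1 - t) * x / d" using ld(2) d by (metis less_irrefl nonzero_eq_divide_eq)
  moreover have "(1 - t) * x / d \<ge> 0" using t xy d by simp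
  ultimately have l1: "l \<le> 1" using l2 by linarith
  have "c / d = (1 - l) *\<^sub>R (c / x) + l *\<^sub>R (c / y)"
    using xy d unfolding l2 by (simp add: l_def) (simp add: field_simps)
  hence "U (c / d) \<le> (1 - l) * U (c / x) + l * U (c / y)"
    using convex_onD[OF U l l1, of "c / x" "c / y"] c xy by simp
  hence "U (c / d) * d \<le> ((1 - l) * U (c / x) + l * U (c / y)) * d"
    using d by (intro mult_right_mono) auto
  also have "\<dots> = ((1 - l) * d) * U (c / x) + (l * d) * U (c / y)"
    by (simp only: algebra_simps)
  also have "\<dots> = (1 - t) * (U (c / x) * x) + t * (U (c / y) * y)"
    unfolding ld by (simp only: mult_ac)
  finally show "U (c / ((1 - t) *\<^sub>R x + t *\<^sub>R y)) * ((1 - t) *\<^sub>R x + t *\<^sub>R y)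
      \<le> (1 - t) * (U (c / x) * x) + t * (U (c / y) * y)"
    by (simp add: d_def)
qed (rule convex_real_interval)

text \<open>The witness is the right derivative, the infimum of chord slopes to the right. Adding
  the inequalities from \<open>x\<close> to \<open>y\<close> and from \<open>y\<close> to
  \<open>x\<close> cancels \<open>h\<close> and yields monotonicity.\<close>

lemma convex_on_subgradient:
  fixes h :: "real \<Rightarrow> real"
  assumes h: "convex_on S h" and S: "open S"
  obtains m where "\<And>x y. x \<in> S \<Longrightarrow> y \<in> S \<Longrightarrow> h x + m x * (y - x) \<le> h y" "mono_on S m"
proof -
  have "\<exists>m. \<forall>x\<in>S. \<forall>y\<in>S. h x + m x * (y - x) \<le> h y"
  proof (intro exI ballI)
    fix x y assume "x \<in> S" "y \<in> S"
    thus "h x + Inf ((\<lambda>t. (h x - h t) / (x - t)) ` ({x<..} \<inter> S)) * (y - x) \<le> h y"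
      using convex_le_Inf_differential[OF h, of x y] S by (simp add: interior_open)
  qed
  then obtain m where m: "\<And>x y. x \<in> S \<Longrightarrow> y \<in> S \<Longrightarrow> h x + m x * (y - x) \<le> h y" by blast
  have "m x \<le> m y" if "x \<in> S" "y \<in> S" "x \<le> y" for x y
  proof (cases "x = y")
    case False
    have "m x * (y - x) \<le> m y * (y - x)"
      using m[of x y] m[of y x] that by (simp add: algebra_simps)
    thus ?thesis using False that by simp
  qed simp
  thus ?thesis using m that[of m] by (auto intro!: mono_onI)
qed

section \<open>Tools from the calculus of variations\<close>

text \<open>Differentiability of the merely continuous \<open>f\<close> is a conclusion: the weak
  equation forces \<open>f\<close> to differ from a primitive \<open>K\<close> of \<open>k\<close>
  by a constant.\<close>

lemma du_Bois_Reymond: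
  fixes f k :: "real \<Rightarrow> real"
  assumes ab: "a < b" and f: "continuous_on {a..b} f" and k: "continuous_on {a..b} k"
    and weak: "\<And>\<zeta> \<zeta>'. \<lbrakk>\<And>s. s \<in> {a..b} \<Longrightarrow> (\<zeta> has_real_derivative \<zeta>' s) (at s within {a..b});
        continuous_on {a..b} \<zeta>'; \<zeta> a = 0; \<zeta> b = 0\<rbrakk>
        \<Longrightarrow> integral {a..b} (\<lambda>s. f s * \<zeta>' s + k s * \<zeta> s) = 0"
    and t: "t \<in> {a..b}"
  shows "(f has_real_derivative k t) (at t within {a..b})"
proof -
  define K where "K t = integral {a..t} k" for t
  have K: "(K has_real_derivative k s) (at s within {a..b})" if "s \<in> {a..b}" for s
    unfolding K_def by (rule integral_has_real_derivative[OF k that])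
  have Kc: "continuous_on {a..b} K" using K by (rule DERIV_continuous_on)
  \<comment> \<open>The test function \<open>Z\<close> has derivative \<open>z = f - K - c\<close>, where \<open>c\<close> is the mean of \<open>f - K\<close>;
    it turns the weak equation into \<open>\<integral> z\<^sup>2 = 0\<close>.\<close>
  define c where "c = integral {a..b} (\<lambda>s. f s - K s) / (b - a)"
  define z where "z s = f s - K s - c" for s
  have zc: "continuous_on {a..b} z" unfolding z_def by (intro continuous_intros f Kc)
  define Z where "Z t = integral {a..t} z" for t
  have Z: "(Z has_real_derivative z s) (at s within {a..b})" if "s \<in> {a..b}" for s
    unfolding Z_def by (rule integral_has_real_derivative[OF zc that])
  have Zc: "continuous_on {a..b} Z" using Z by (rule DERIV_continuous_on)
  have "Z b = integral {a..b} (\<lambda>s. f s - K s) - integral {a..b} (\<lambda>s. c)"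
    unfolding Z_def z_def
    by (intro Henstock_Kurzweil_Integration.integral_diff integrable_continuous_real continuous_intros f Kc)
  hence Zb: "Z b = 0" using ab by (simp add: c_def)
  have Za: "Z a = 0" by (simp add: Z_def)
  have "((\<lambda>s. f s * z s + k s * Z s) has_integral
      integral {a..b} (\<lambda>s. f s * z s + k s * Z s)) {a..b}"
    by (intro integrable_integral integrable_continuous_real continuous_intros f zc k Zc)
  hence 1: "((\<lambda>s. f s * z s + k s * Z s) has_integral 0) {a..b}"
    by (simp only: weak[OF Z zc Za Zb])
  \<comment> \<open>\<open>(K s + c) * Z s\<close> is a primitive of this integrand and vanishes at
    both ends; subtracting from fact \<open>1\<close> leaves \<open>(f s - K s - c) * z s\<close>,
    which is the square of \<open>z s\<close>.\<close>
  have 2: "((\<lambda>s. k s * Z s + z s * (K s + c)) has_integral (K b + c) * Z b - (K a + c) * Z a) {a..b}"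
    by (rule fundamental_theorem_of_calculus)
       (use ab in \<open>auto simp flip: has_real_derivative_iff_has_vector_derivative
          intro!: derivative_eq_intros K Z\<close>)
  have "((\<lambda>s. (z s)\<^sup>2) has_integral 0) {a..b}"
    using has_integral_diff[OF 1 2] by (simp add: Za Zb z_def algebra_simps power2_eq_square)
  hence z0: "z s = 0" if "s \<in> {a..b}" for s
    using has_integral_0_cbox_imp_0[of a b "\<lambda>s. (z s)\<^sup>2" s] that ab zc
    by (auto intro!: continuous_intros)
  hence eq: "f s = K s + c" if "s \<in> {a..b}" for s using z0[OF that] by (simp add: z_def)
  have "((\<lambda>s. K s + c) has_real_derivative k t) (at t within {a..b})"
    by (auto intro!: derivative_eq_intros K t)
  thus ?thesis
    by (rule has_field_derivative_transform_within[where d=1]) (use t eq in auto)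
qed

text \<open>Differentiation under the integral sign for the first variation. The radius
  \<open>e0\<close> keeps the arguments in \<open>S\<close>, because the interaction energy is
  differentiable only at positive gaps.\<close>

lemma has_real_derivative_integral_affine_variation:
  fixes f f' u w :: "real \<Rightarrow> real"
  assumes e0: "e0 > 0" and f: "\<And>y. y \<in> S \<Longrightarrow> (f has_real_derivative f' y) (at y)"
    and f': "continuous_on S f'" and u: "continuous_on {a..b} u" and w: "continuous_on {a..b} w"
    and S: "\<And>e s. e \<in> {-e0..e0} \<Longrightarrow> s \<in> {a..b} \<Longrightarrow> u s + e * w s \<in> S"
  shows "((\<lambda>e. integral {a..b} (\<lambda>s. f (u s + e * w s))) has_real_derivative
            integral {a..b} (\<lambda>s. f' (u s) * w s)) (at 0)"
proof -
  have fc: "continuous_on S f"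
    using f by (meson DERIV_isCont continuous_at_imp_continuous_on)
  have "((\<lambda>e. integral (cbox a b) (\<lambda>s. f (u s + e * w s))) has_real_derivative
            integral (cbox a b) (\<lambda>s. f' (u s + 0 * w s) * w s)) (at 0 within {-e0..e0})"
  proof (rule leibniz_rule_field_derivative)
    fix e s assume es: "e \<in> {-e0..e0}" "s \<in> cbox a b"
    have "((\<lambda>e. f (u s + e * w s)) has_real_derivative f' (u s + e * w s) * w s) (at e)"
      by (rule DERIV_chain2[OF f]) (use es S in \<open>auto intro!: derivative_eq_intros\<close>)
    thus "((\<lambda>e. f (u s + e * w s)) has_real_derivative f' (u s + e * w s) * w s) (at e within {-e0..e0})"
      by (rule has_field_derivative_at_within)
  next
    fix e assume e: "e \<in> {-e0..e0}"
    show "(\<lambda>s. f (u s + e * w s)) integrable_on cbox a b"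
      by (rule integrable_continuous, rule continuous_on_compose2[OF fc])
         (use S e in \<open>auto intro!: continuous_intros u w\<close>)
  next
    have "continuous_on ({- e0..e0} \<times> {a..b}) (\<lambda>p. f' (u (snd p) + fst p * w (snd p)) * w (snd p))"
      by (intro continuous_intros continuous_on_compose2[OF f'] continuous_on_compose2[OF u] continuous_on_compose2[OF w])
         (use S in auto)
    thus "continuous_on ({- e0..e0} \<times> cbox a b) (\<lambda>(e, s). f' (u s + e * w s) * w s)"
      by (simp add: case_prod_unfold)
  qed (use e0 in auto)
  moreover have "at 0 within {-e0..e0} = at (0::real)"
    using e0 by (intro at_within_interior) auto
  ultimately show ?thesis by simp
qed

section \<open>Cyclic indices and gaps\<close>

text \<open>Indices are taken modulo \<open>N\<close> with representatives 1 to \<open>N\<close>;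
  \<open>cyc_succ\<close> is the inverse permutation.\<close>

definition cyc_pred :: "nat \<Rightarrow> nat \<Rightarrow> nat" where
  "cyc_pred N i = (if i = 1 then N else i - 1)"

definition cyc_succ :: "nat \<Rightarrow> nat \<Rightarrow> nat" where
  "cyc_succ N i = (if i = N then 1 else i + 1)"

lemma cyc_pred_in: "i \<in> {1..N} \<Longrightarrow> cyc_pred N i \<in> {1..N}"
  and cyc_succ_in: "i \<in> {1..N} \<Longrightarrow> cyc_succ N i \<in> {1..N}"
  by (auto simp: cyc_pred_def cyc_succ_def)

text \<open>The convention for particle 0 enters only as an additive constant, so variations and
  second differences of gaps are plain cyclic differences.\<close>

lemma gap_cyc_pred: "gap N p i = p i - p (cyc_pred N i) + (if i = 1 then 1 else 0)"
  by (simp add: gap_def cyc_pred_def)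

text \<open>The two shifts are inverse permutations of \<open>{1..N}\<close>, so summation by parts
  has no boundary term. It passes between sums over gaps and sums over particles.\<close>

lemma sum_cyc_by_parts:
  fixes a b :: "nat \<Rightarrow> 'a::comm_ring"
  shows "(\<Sum>j=1..N. a j * (b j - b (cyc_pred N j))) = (\<Sum>j=1..N. (a j - a (cyc_succ N j)) * b j)"
proof -
  have "(\<Sum>j=1..N. a j * b (cyc_pred N j)) = (\<Sum>j=1..N. a (cyc_succ N j) * b j)"
    by (rule sum.reindex_bij_witness[of _ "cyc_succ N" "cyc_pred N"])
       (auto simp: cyc_pred_def cyc_succ_def split: if_splits)
  thus ?thesis by (simp add: algebra_simps sum_subtractf)
qed

lemma config_spaceI:
  assumes N: "N \<ge> 1" and gap: "\<And>i. i \<in> {1..N} \<Longrightarrow> gap N p i \<ge> 0"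
  shows "p \<in> config_space N"
proof -
  have "p i \<le> p (i + 1)" if "i \<in> {1..<N}" for i
    using gap[of "i + 1"] that by (auto simp: gap_def)
  moreover have "p N \<le> p 1 + 1" using gap[of 1] N by (auto simp: gap_def)
  ultimately show ?thesis by (auto simp: config_space_def)
qed

section \<open>Regular curves and the value of the action\<close>

lemma C1_on_imp_continuous_on: "C1_on f S \<Longrightarrow> continuous_on S f"
  by (auto simp: C1_on_def continuous_on_eq_continuous_within intro: has_derivative_continuous)

lemma C1_on_real:
  fixes f :: "real \<Rightarrow> real"
  assumes "C1_on f S"
  shows "\<exists>f'. (\<forall>x\<in>S. (f has_real_derivative f' x) (at x within S)) \<and> continuous_on S f'"
proof -
  from assms obtain F :: "real \<Rightarrow> real \<Rightarrow>\<^sub>L real" where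
    F: "\<And>x. x \<in> S \<Longrightarrow> (f has_derivative blinfun_apply (F x)) (at x within S)" "continuous_on S F"
    unfolding C1_on_def by blast
  show ?thesis
  proof (intro exI[of _ "\<lambda>x. F x 1"] conjI ballI)
    fix x assume "x \<in> S"
    have "blinfun_apply (F x) = (*) (F x 1)"
    proof
      fix h show "F x h = F x 1 * h"
        using blinfun.scaleR_right[of "F x" h 1] by (simp add: mult.commute)
    qed
    thus "(f has_real_derivative F x 1) (at x within S)"
      using F(1)[OF \<open>x \<in> S\<close>] by (simp add: has_field_derivative_def)
  qed (intro continuous_intros F)
qed

text \<open>By compactness the derivative is bounded, so \<open>f\<close> is Lipschitz. This makes
  C1 perturbations admissible competitors.\<close>

lemma abs_cont_on_C1:
  assumes deriv: "\<And>s. s \<in> {a..b} \<Longrightarrow> (f has_real_derivative f' s) (at s within {a..b})"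
    and f': "continuous_on {a..b} f'"
  shows "abs_cont_on f {a..b}"
proof -
  have "bounded (f' ` {a..b})"
    by (intro compact_imp_bounded compact_continuous_image f' compact_Icc)
  then obtain M where M: "M > 0" "\<And>s. s \<in> {a..b} \<Longrightarrow> norm (f' s) \<le> M"
    by (auto simp: bounded_pos)
  have lip: "\<bar>f s - f t\<bar> \<le> M * \<bar>s - t\<bar>" if "s \<in> {a..b}" "t \<in> {a..b}" for s t
    using field_differentiable_bound[of "{a..b}" f f' M s t] deriv M(2) that by auto
  show ?thesis
    unfolding abs_cont_on_def
  proof (intro allI impI)
    fix e :: real assume "e > 0"
    show "\<exists>\<delta>>0. \<forall>(n::nat) a' b'.
        (\<forall>k<n. a' k \<le> b' k \<and> {a' k..b' k} \<subseteq> {a..b}) \<and>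
        disjoint_family_on (\<lambda>k. {a' k<..<b' k}) {..<n} \<and> (\<Sum>k<n. b' k - a' k) < \<delta>
        \<longrightarrow> (\<Sum>k<n. \<bar>f (b' k) - f (a' k)\<bar>) < e"
    proof (intro exI[of _ "e / M"] conjI allI impI)
      fix n :: nat and a' b' :: "nat \<Rightarrow> real"
      assume *: "(\<forall>k<n. a' k \<le> b' k \<and> {a' k..b' k} \<subseteq> {a..b}) \<and>
        disjoint_family_on (\<lambda>k. {a' k<..<b' k}) {..<n} \<and> (\<Sum>k<n. b' k - a' k) < e / M"
      have "\<bar>f (b' k) - f (a' k)\<bar> \<le> M * (b' k - a' k)" if "k < n" for k
        using lip[of "b' k" "a' k"] * that by force
      hence "(\<Sum>k<n. \<bar>f (b' k) - f (a' k)\<bar>) \<le> M * (\<Sum>k<n. b' k - a' k)"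
        unfolding sum_distrib_left by (intro sum_mono) auto
      also have "\<dots> < M * (e / M)" using * M(1) by (intro mult_strict_left_mono) auto
      finally show "(\<Sum>k<n. \<bar>f (b' k) - f (a' k)\<bar>) < e" using M(1) by simp
    qed (use \<open>e > 0\<close> M in auto)
  qed
qed

text \<open>Agreement is asked only on the open interval because \<open>deriv\<close> is
  uncontrolled at the endpoints, a null set. Both parts of \<open>f\<close> have finite integral, so
  the extended difference is an ordinary one.\<close>

lemma ereal_integral_eq_integral:
  fixes f :: "real \<Rightarrow> real"
  assumes f: "continuous_on {a..b} f" and h: "\<And>s. s \<in> {a<..<b} \<Longrightarrow> h s = ereal (f s)"
  shows "ereal_integral (lebesgue_on {a..b}) h = ereal (integral {a..b} f)"
proof -
  let ?M = "lebesgue_on {a..b}"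
  have int: "integrable ?M f" using continuous_imp_integrable[of a b f] f by simp
  have "{a, b} \<in> null_sets lebesgue"
    by (subst negligible_iff_null_sets[symmetric]) (rule negligible_finite, simp)
  hence "AE s in lebesgue. s \<notin> {a, b}" by (rule AE_not_in)
  hence "AE s in lebesgue. s \<in> {a..b} \<longrightarrow> s \<in> {a<..<b}" by eventually_elim auto
  hence AE: "AE s in ?M. s \<in> {a<..<b}" by (subst AE_restrict_space_iff) auto
  have "(\<integral>\<^sup>+s. e2ennreal (h s) \<partial>?M) = (\<integral>\<^sup>+s. ennreal (f s) \<partial>?M)"
    by (rule nn_integral_cong_AE, use AE in eventually_elim) (simp add: h ennreal.rep_eq e2ennreal_ereal)
  moreover have "(\<integral>\<^sup>+s. e2ennreal (- h s) \<partial>?M) = (\<integral>\<^sup>+s. ennreal (- f s) \<partial>?M)"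
    by (rule nn_integral_cong_AE, use AE in eventually_elim) (simp add: h e2ennreal_ereal)
  moreover obtain p where p: "p \<ge> 0" "(\<integral>\<^sup>+s. ennreal (f s) \<partial>?M) = ennreal p"
    using integrableD(2)[OF int] by (cases "\<integral>\<^sup>+s. ennreal (f s) \<partial>?M") auto
  moreover obtain q where q: "q \<ge> 0" "(\<integral>\<^sup>+s. ennreal (- f s) \<partial>?M) = ennreal q"
    using integrableD(3)[OF int] by (cases "\<integral>\<^sup>+s. ennreal (- f s) \<partial>?M") auto
  moreover have "integral {a..b} f = p - q"
    using lebesgue_integral_eq_integral[OF int] real_lebesgue_integral_def[OF int] p q by simp
  ultimately show ?thesis by (simp add: ereal_integral_def)
qed

text \<open>Positive gaps keep \<open>G_term\<close> out of its limit branch, so all integrands are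
  continuous and the action is a real number. A potential depending on time alone contributes the
  same amount for every curve.\<close>

lemma action_C1:
  fixes x :: "real \<Rightarrow> nat \<Rightarrow> real"
  assumes L: "continuous_on UNIV L" and G: "continuous_on {0<..} G"
    and V: "\<And>y s. s \<in> {0..T} \<Longrightarrow> V y s = W s" "continuous_on {0..T} W"
    and N: "N \<ge> 1"
    and deriv: "\<And>i s. i \<in> {1..N} \<Longrightarrow> s \<in> {0..T} \<Longrightarrow>
                  ((\<lambda>t. x t i) has_real_derivative v i s) (at s within {0..T})"
    and v: "\<And>i. i \<in> {1..N} \<Longrightarrow> continuous_on {0..T} (v i)"
    and gap: "\<And>i s. i \<in> {1..N} \<Longrightarrow> s \<in> {0..T} \<Longrightarrow> gap N (x s) i > 0"
  shows "action L G V N T x = ereal (1 / real N * (\<Sum>i=1..N.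
      integral {0..T} (\<lambda>s. L (v i s)) + integral {0..T} (\<lambda>s. G (1 / real N / gap N (x s) i))
        - integral {0..T} W))"
proof -
  have xc: "continuous_on {0..T} (\<lambda>s. x s i)" if "i \<in> {1..N}" for i
    using deriv[OF that] by (rule DERIV_continuous_on)
  have gc: "continuous_on {0..T} (\<lambda>s. gap N (x s) i)" if "i \<in> {1..N}" for i
    unfolding gap_cyc_pred by (intro continuous_intros xc cyc_pred_in that)
  have "ereal_integral (lebesgue_on {0..T})
        (\<lambda>s. ereal (L (deriv (\<lambda>r. x r i) s)) + G_term G N (x s) i - ereal (V (x s i) s))
      = ereal (integral {0..T} (\<lambda>s. L (v i s)) + integral {0..T} (\<lambda>s. G (1 / real N / gap N (x s) i))
        - integral {0..T} W)" (is "_ = ereal ?I") if i: "i \<in> {1..N}" for i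
  proof -
    have Lc: "continuous_on {0..T} (\<lambda>s. L (v i s))"
      by (rule continuous_on_compose2[OF L v[OF i]]) simp
    have Gc: "continuous_on {0..T} (\<lambda>s. G (1 / real N / gap N (x s) i))"
    proof (rule continuous_on_compose2[OF G])
      show "continuous_on {0..T} (\<lambda>s. 1 / real N / gap N (x s) i)"
        by (intro continuous_intros gc i) (use gap[OF i] in force)
    qed (use gap[OF i] N in auto)
    have "ereal_integral (lebesgue_on {0..T})
        (\<lambda>s. ereal (L (deriv (\<lambda>r. x r i) s)) + G_term G N (x s) i - ereal (V (x s i) s))
      = ereal (integral {0..T} (\<lambda>s. L (v i s) + G (1 / real N / gap N (x s) i) - W s))"
    proof (rule ereal_integral_eq_integral)
      fix s assume s: "s \<in> {0<..<T}"
      have "((\<lambda>t. x t i) has_real_derivative v i s) (at s)"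
        using deriv[OF i, of s] s at_within_interior[of s "{0..T}"] by auto
      hence "deriv (\<lambda>r. x r i) s = v i s" by (rule DERIV_imp_deriv)
      thus "ereal (L (deriv (\<lambda>r. x r i) s)) + G_term G N (x s) i - ereal (V (x s i) s)
          = ereal (L (v i s) + G (1 / real N / gap N (x s) i) - W s)"
        using gap[OF i, of s] V(1)[of s] s by (simp add: G_term_def particle_density_def)
    qed (intro continuous_intros Lc Gc V)
    also have "integral {0..T} (\<lambda>s. L (v i s) + G (1 / real N / gap N (x s) i) - W s) = ?I"
      by (subst Henstock_Kurzweil_Integration.integral_diff Henstock_Kurzweil_Integration.integral_add;
          (intro integrable_continuous_real continuous_intros Lc Gc V)?)+ simp
    finally show ?thesis .
  qed
  thus ?thesis unfolding action_def by simp
qed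

section \<open>First variation and Euler-Lagrange equations\<close>

text \<open>By compactness \<open>d\<close> has a positive minimum and \<open>\<delta>\<close> is
  bounded; any positive \<open>e0\<close> below the quotient of minimum and bound works.\<close>

lemma eventually_affine_perturbation_pos:
  fixes d \<delta> :: "real \<Rightarrow> real"
  assumes d: "continuous_on {a..b} d" and \<delta>: "continuous_on {a..b} \<delta>"
    and pos: "\<And>s. s \<in> {a..b} \<Longrightarrow> d s > 0" and ab: "a \<le> b"
  shows "\<forall>\<^sub>F e0 in at_right 0. \<forall>s\<in>{a..b}. \<forall>e\<in>{-e0..e0}. d s + e * \<delta> s > 0"
proof -
  obtain s0 where s0: "s0 \<in> {a..b}" "\<And>s. s \<in> {a..b} \<Longrightarrow> d s0 \<le> d s"
    using continuous_attains_inf[OF compact_Icc _ d] ab by auto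
  have "bounded (\<delta> ` {a..b})"
    by (intro compact_imp_bounded compact_continuous_image \<delta> compact_Icc)
  then obtain M where M: "M > 0" "\<And>s. s \<in> {a..b} \<Longrightarrow> \<bar>\<delta> s\<bar> \<le> M"
    by (auto simp: bounded_pos)
  have "\<forall>\<^sub>F e0 in at_right 0. e0 \<in> {0<..<d s0 / M}"
    by (rule eventually_at_right_real) (use pos s0 M in auto)
  thus ?thesis
  proof eventually_elim
    case (elim e0)
    show ?case
    proof (intro ballI)
      fix s e assume s: "s \<in> {a..b}" and e: "e \<in> {-e0..e0}"
      have "\<bar>e * \<delta> s\<bar> \<le> e0 * M" unfolding abs_mult by (rule mult_mono) (use s e M elim in auto)
      also have "\<dots> < d s0" using elim M by (auto simp: field_simps)
      finally show "d s + e * \<delta> s > 0" using s0(2)[OF s] by linarith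
    qed
  qed
qed

text \<open>Particle \<open>i\<close> alone is moved, by a test function vanishing at both ends,
  which affects only its adjacent gaps. Minimality gives a weak equation, and
  \<open>du_Bois_Reymond\<close> makes it a differential equation for the momentum
  \<open>L' (v i s)\<close>.\<close>

lemma euler_lagrange:
  fixes x :: "real \<Rightarrow> nat \<Rightarrow> real"
  assumes L: "\<And>u. (L has_real_derivative L' u) (at u)" "continuous_on UNIV L'"
    and G: "\<And>r. r > 0 \<Longrightarrow> (G has_real_derivative G' r) (at r)" "continuous_on {0<..} G'"
    and V: "\<And>y s. s \<in> {0..T} \<Longrightarrow> V y s = W s" "continuous_on {0..T} W"
    and N: "N \<ge> 1" and T: "T > 0"
    and sol: "is_solution L G V N T p q x"
    and deriv: "\<And>i s. i \<in> {1..N} \<Longrightarrow> s \<in> {0..T} \<Longrightarrow>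
                  ((\<lambda>t. x t i) has_real_derivative v i s) (at s within {0..T})"
    and v: "\<And>i. i \<in> {1..N} \<Longrightarrow> continuous_on {0..T} (v i)"
    and gap: "\<And>i s. i \<in> {1..N} \<Longrightarrow> s \<in> {0..T} \<Longrightarrow> gap N (x s) i > 0"
    and i: "i \<in> {1..N}" and t: "t \<in> {0..T}"
  defines "\<Gamma> \<equiv> \<lambda>d. - (1 / real N / d\<^sup>2 * G' (1 / real N / d))"
  shows "((\<lambda>s. L' (v i s)) has_real_derivative
           \<Gamma> (gap N (x t) i) - \<Gamma> (gap N (x t) (cyc_succ N i))) (at t within {0..T})"
proof (rule du_Bois_Reymond[OF T _ _ _ t])
  have xc: "continuous_on {0..T} (\<lambda>s. x s i)" if "i \<in> {1..N}" for i
    using deriv[OF that] by (rule DERIV_continuous_on)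
  have gc: "continuous_on {0..T} (\<lambda>s. gap N (x s) i)" if "i \<in> {1..N}" for i
    unfolding gap_cyc_pred by (intro continuous_intros xc cyc_pred_in that)
  have Lc: "continuous_on UNIV L" using L(1) by (meson DERIV_isCont continuous_at_imp_continuous_on)
  have Gc: "continuous_on {0<..} G"
    using G(1) by (meson DERIV_isCont continuous_at_imp_continuous_on greaterThan_iff)
  have \<Gamma>c: "continuous_on {0<..} \<Gamma>"
    unfolding \<Gamma>_def by (intro continuous_intros continuous_on_compose2[OF G(2)]) (use N in auto)
  have G\<Gamma>: "((\<lambda>d. G (1 / real N / d)) has_real_derivative \<Gamma> d) (at d)" if "d > 0" for d
  proof -
    have "((\<lambda>d. G (1 / real N / d)) has_real_derivative G' (1 / real N / d) * (- (1 / real N / d\<^sup>2))) (at d)"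
      by (rule DERIV_chain2[OF G(1)])
         (use that N in \<open>auto intro!: derivative_eq_intros simp: power2_eq_square\<close>)
    thus ?thesis by (simp add: \<Gamma>_def mult.commute)
  qed
  show L'v: "continuous_on {0..T} (\<lambda>s. L' (v i s))"
    by (rule continuous_on_compose2[OF L(2) v[OF i]]) simp
  show kc: "continuous_on {0..T} (\<lambda>s. \<Gamma> (gap N (x s) i) - \<Gamma> (gap N (x s) (cyc_succ N i)))"
    by (intro continuous_intros continuous_on_compose2[OF \<Gamma>c] gc i cyc_succ_in)
       (use gap i cyc_succ_in[OF i] in auto)
  fix \<zeta> \<zeta>' :: "real \<Rightarrow> real"
  assume \<zeta>: "\<And>s. s \<in> {0..T} \<Longrightarrow> (\<zeta> has_real_derivative \<zeta>' s) (at s within {0..T})"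
    and \<zeta>': "continuous_on {0..T} \<zeta>'" and \<zeta>0: "\<zeta> 0 = 0" "\<zeta> T = 0"
  have \<zeta>c: "continuous_on {0..T} \<zeta>" using \<zeta> by (rule DERIV_continuous_on)
  define \<eta> where "\<eta> s j = (if j = i then \<zeta> s else 0)" for s j
  define \<eta>' where "\<eta>' j s = (if j = i then \<zeta>' s else 0)" for s j
  \<comment> \<open>This is the change of gap \<open>j\<close> per unit of \<open>e\<close>. For
    \<open>N = 1\<close> the only gap does not change, in line with the cancelling
    \<open>\<Gamma>\<close> terms.\<close>
  define \<delta> where "\<delta> j s = \<eta> s j - \<eta> s (cyc_pred N j)" for j s
  have \<eta>c: "continuous_on {0..T} (\<lambda>s. \<eta> s j)" for j
    using \<zeta>c by (cases "j = i") (auto simp: \<eta>_def)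
  have \<eta>'c: "continuous_on {0..T} (\<eta>' j)" for j
    using \<zeta>' by (cases "j = i") (auto simp: \<eta>'_def [abs_def])
  have \<eta>d: "((\<lambda>s. \<eta> s j) has_real_derivative \<eta>' j s) (at s within {0..T})" if "s \<in> {0..T}" for s j
    using \<zeta>[OF that] by (cases "j = i") (auto simp: \<eta>_def \<eta>'_def)
  have \<delta>c: "continuous_on {0..T} (\<delta> j)" for j
    unfolding \<delta>_def by (intro continuous_intros \<eta>c)
  define y where "y e s j = x s j + e * \<eta> s j" for e s j
  have gap_y: "gap N (y e s) j = gap N (x s) j + e * \<delta> j s" for e s j
    by (simp add: gap_cyc_pred y_def \<delta>_def algebra_simps)
  have y0: "y 0 = x" by (simp add: y_def fun_eq_iff)
  \<comment> \<open>One \<open>e0\<close> has to serve all gaps, all times and both signs of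
    \<open>e\<close>; then every \<open>y e\<close> is admissible and \<open>action_C1\<close>
    applies to it.\<close>
  have "\<forall>\<^sub>F e0 in at_right 0. \<forall>j\<in>{1..N}. \<forall>s\<in>{0..T}. \<forall>e\<in>{-e0..e0}. gap N (x s) j + e * \<delta> j s > 0"
    by (rule eventually_ball_finite)
       (use eventually_affine_perturbation_pos[OF gc \<delta>c gap] T in auto)
  moreover have "\<forall>\<^sub>F e0 in at_right (0::real). e0 > 0" by (rule eventually_at_right_less)
  ultimately have "\<forall>\<^sub>F e0 in at_right 0. e0 > 0 \<and>
      (\<forall>j\<in>{1..N}. \<forall>s\<in>{0..T}. \<forall>e\<in>{-e0..e0}. gap N (x s) j + e * \<delta> j s > 0)"
    by eventually_elim simp
  then obtain e0 where e0: "e0 > 0"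
    and pos: "\<And>j s e. j \<in> {1..N} \<Longrightarrow> s \<in> {0..T} \<Longrightarrow> e \<in> {-e0..e0} \<Longrightarrow> gap N (x s) j + e * \<delta> j s > 0"
    using eventually_happens[of _ "at_right (0::real)"] trivial_limit_at_right_real by blast
  have yd: "((\<lambda>s. y e s j) has_real_derivative v j s + e * \<eta>' j s) (at s within {0..T})"
    if "j \<in> {1..N}" "s \<in> {0..T}" for e j s
    unfolding y_def using deriv[OF that] \<eta>d[OF that(2)] by (auto intro!: derivative_eq_intros)
  have y'c: "continuous_on {0..T} (\<lambda>s. v j s + e * \<eta>' j s)" if "j \<in> {1..N}" for e j
    by (intro continuous_intros v that \<eta>'c)
  have x_adm: "admissible N T p q x" using sol by (simp add: is_solution_def)
  have y_adm: "admissible N T p q (y e)" if e: "e \<in> {-e0..e0}" for e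
    unfolding admissible_def
  proof (intro conjI ballI)
    fix j assume j: "j \<in> {1..N}"
    show "abs_cont_on (\<lambda>s. y e s j) {0..T}"
      using yd[OF j] y'c[OF j] by (rule abs_cont_on_C1)
    show "y e 0 j = p j" "y e T j = q j"
      using x_adm j by (auto simp: admissible_def y_def \<eta>_def \<zeta>0)
  next
    fix s assume "s \<in> {0..T}"
    show "y e s \<in> config_space N"
      by (rule config_spaceI[OF N]) (use pos[OF _ \<open>s \<in> {0..T}\<close> e] gap_y in \<open>auto intro: less_imp_le\<close>)
  qed
  \<comment> \<open>This is \<open>N\<close> times the action of \<open>y e\<close>, as a real
    function of \<open>e\<close> that can be differentiated.\<close>
  define J where "J e = (\<Sum>j=1..N. integral {0..T} (\<lambda>s. L (v j s + e * \<eta>' j s))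
      + integral {0..T} (\<lambda>s. G (1 / real N / (gap N (x s) j + e * \<delta> j s))) - integral {0..T} W)" for e
  have act: "action L G V N T (y e) = ereal (1 / real N * J e)" if e: "e \<in> {-e0..e0}" for e
    unfolding J_def gap_y[symmetric]
    by (rule action_C1[OF Lc Gc V N yd y'c]) (use pos e gap_y in auto)
  have J_min: "J 0 \<le> J e" if e: "e \<in> {-e0..e0}" for e
  proof -
    have "action L G V N T (y 0) \<le> action L G V N T (y e)"
      using sol y_adm[OF e] by (simp add: y0 is_solution_def)
    thus ?thesis using act[OF e] act[of 0] e0 N by (simp add: divide_le_cancel)
  qed
  let ?D = "\<Sum>j=1..N. integral {0..T} (\<lambda>s. L' (v j s) * \<eta>' j s)
      + integral {0..T} (\<lambda>s. \<Gamma> (gap N (x s) j) * \<delta> j s)"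
  \<comment> \<open>The final \<open>0\<close> is the derivative of the potential term, which does
    not depend on \<open>e\<close>.\<close>
  have "(J has_real_derivative (\<Sum>j=1..N. integral {0..T} (\<lambda>s. L' (v j s) * \<eta>' j s)
      + integral {0..T} (\<lambda>s. \<Gamma> (gap N (x s) j) * \<delta> j s) - 0)) (at 0)"
    unfolding J_def
  proof (intro DERIV_sum DERIV_diff DERIV_add DERIV_const)
    fix j assume j: "j \<in> {1..N}"
    show "((\<lambda>e. integral {0..T} (\<lambda>s. L (v j s + e * \<eta>' j s))) has_real_derivative
        integral {0..T} (\<lambda>s. L' (v j s) * \<eta>' j s)) (at 0)"
      by (rule has_real_derivative_integral_affine_variation[OF e0 L v[OF j] \<eta>'c]) auto
    show "((\<lambda>e. integral {0..T} (\<lambda>s. G (1 / real N / (gap N (x s) j + e * \<delta> j s)))) has_real_derivative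
        integral {0..T} (\<lambda>s. \<Gamma> (gap N (x s) j) * \<delta> j s)) (at 0)"
      by (rule has_real_derivative_integral_affine_variation[where f = "\<lambda>d. G (1 / real N / d)",
            OF e0 G\<Gamma> \<Gamma>c gc[OF j] \<delta>c]) (use pos j in auto)
  qed
  moreover have "\<forall>e. \<bar>0 - e\<bar> < e0 \<longrightarrow> J 0 \<le> J e" using J_min by (auto simp: abs_less_iff)
  ultimately have "?D = 0" using DERIV_local_min[of J ?D 0 e0] e0 by simp
  have \<Gamma>gc: "continuous_on {0..T} (\<lambda>s. \<Gamma> (gap N (x s) j))" if "j \<in> {1..N}" for j
    by (rule continuous_on_compose2[OF \<Gamma>c gc[OF that]]) (use gap that in auto)
  have L'vc: "continuous_on {0..T} (\<lambda>s. L' (v j s))" if "j \<in> {1..N}" for j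
    by (rule continuous_on_compose2[OF L(2) v[OF that]]) simp
  have delta: "(\<Sum>j=1..N. c j * (if j = i then z else 0)) = c i * z" for c :: "nat \<Rightarrow> real" and z
    using i by (subst sum.remove[of _ i]) (auto intro!: sum.neutral)
  have sum_eq: "(\<Sum>j=1..N. L' (v j s) * \<eta>' j s + \<Gamma> (gap N (x s) j) * \<delta> j s)
      = L' (v i s) * \<zeta>' s + (\<Gamma> (gap N (x s) i) - \<Gamma> (gap N (x s) (cyc_succ N i))) * \<zeta> s" for s
  proof -
    \<comment> \<open>Summation by parts moves the cyclic difference from \<open>\<eta>\<close> to
      \<open>\<Gamma>\<close>, after which only the term \<open>j = i\<close> survives.\<close>
    have "(\<Sum>j=1..N. \<Gamma> (gap N (x s) j) * \<delta> j s)
        = (\<Sum>j=1..N. (\<Gamma> (gap N (x s) j) - \<Gamma> (gap N (x s) (cyc_succ N j))) * \<eta> s j)"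
      unfolding \<delta>_def by (rule sum_cyc_by_parts)
    thus ?thesis
      unfolding sum.distrib by (simp only: \<eta>_def \<eta>'_def delta)
  qed
  have "integral {0..T} (\<lambda>s. L' (v i s) * \<zeta>' s
          + (\<Gamma> (gap N (x s) i) - \<Gamma> (gap N (x s) (cyc_succ N i))) * \<zeta> s)
      = integral {0..T} (\<lambda>s. (\<Sum>j=1..N. L' (v j s) * \<eta>' j s + \<Gamma> (gap N (x s) j) * \<delta> j s))"
    by (simp only: sum_eq)
  also have "\<dots> = (\<Sum>j=1..N. integral {0..T} (\<lambda>s. L' (v j s) * \<eta>' j s + \<Gamma> (gap N (x s) j) * \<delta> j s))"
    by (intro Henstock_Kurzweil_Integration.integral_sum integrable_continuous_real
          continuous_intros L'vc \<Gamma>gc \<eta>'c \<delta>c) auto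
  also have "\<dots> = ?D"
    by (intro sum.cong refl Henstock_Kurzweil_Integration.integral_add integrable_continuous_real
          continuous_intros L'vc \<Gamma>gc \<eta>'c \<delta>c) auto
  also note \<open>?D = 0\<close>
  finally show "integral {0..T} (\<lambda>s. L' (v i s) * \<zeta>' s
      + (\<Gamma> (gap N (x s) i) - \<Gamma> (gap N (x s) (cyc_succ N i))) * \<zeta> s) = 0" .
qed

section \<open>Convexity along the solution\<close>

lemma deriv_ge_0_of_mono_on:
  fixes g :: "real \<Rightarrow> real"
  assumes g: "mono_on {0..} g" and d: "g differentiable at s" and s: "s > 0"
  shows "deriv g s \<ge> 0"
proof (rule mono_on_imp_deriv_nonneg)
  show "(g has_real_derivative deriv g s) (at s)"
    using d by (simp add: DERIV_deriv_iff_real_differentiable)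
qed (use g s in auto)

theorem theorem1p5:
  fixes g G L U :: "real \<Rightarrow> real" and V :: "real \<Rightarrow> real \<Rightarrow> real"
    and N :: nat and T :: real
    and p q :: "nat \<Rightarrow> real" and x :: "real \<Rightarrow> nat \<Rightarrow> real"
  assumes g_C1: "C1_on g {0..}"
    and g_mono: "mono_on {0..} g"
    and g_int: "\<exists>\<epsilon>>0. (\<lambda>r. r * deriv g r) absolutely_integrable_on {0..\<epsilon>}"
    and G_C1: "C1_on G {0<..}"
    and G_deriv: "\<And>r. r > 0 \<Longrightarrow>
          (G has_real_derivative (1 / r\<^sup>2) * integral {0..r} (\<lambda>s. s * deriv g s)) (at r)"
    and G_convex: "convex_on {0<..} G"
    and L_C2: "C1_on L UNIV" "C1_on (deriv L) UNIV"
    and L_bdd: "bdd_below (range L)"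
    and L_unif: "unif_convex L"
    and V_periodic: "\<And>y t. t \<in> {0..T} \<Longrightarrow> V (y + 1) t = V y t"
    and V_C1: "C1_on (\<lambda>(y, t). V y t) (UNIV \<times> {0..T})"
    and V_x: "\<And>y t. t \<in> {0..T} \<Longrightarrow> ((\<lambda>z. V z t) has_real_derivative 0) (at y)"
    and N_pos: "N \<ge> 1" and T_pos: "T > 0"
    and p_config: "p \<in> config_space N" and q_config: "q \<in> config_space N"
    and x_C1: "\<And>i. i \<in> {1..N} \<Longrightarrow> C1_on (\<lambda>t. x t i) {0..T}"
    and x_sol: "is_solution L G V N T p q x"
    and x_strict: "\<And>i t. i \<in> {1..N} \<Longrightarrow> t \<in> {0..T} \<Longrightarrow> gap N (x t) i > 0"
    and U_convex: "convex_on {0..} U"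
  shows "convex_on {0..T} (\<lambda>t. \<Sum>i=1..N. U (particle_density N (x t) i) * gap N (x t) i)"
proof -
  obtain G' where G': "\<forall>r\<in>{0<..}. (G has_real_derivative G' r) (at r within {0<..})"
      and G'c: "continuous_on {0<..} G'"
    using C1_on_real[OF G_C1] by blast
  have GD: "(G has_real_derivative G' r) (at r)" if "r > 0" for r
    using bspec[OF G', of r] that at_within_open[of r "{0<..}"] by simp
  have G'_nonneg: "G' r \<ge> 0" if r: "r > 0" for r
  proof -
    \<comment> \<open>At 0 the function \<open>g\<close> is controlled only from the right, so the
      two-sided \<open>deriv g 0\<close> may be meaningless; the factor \<open>s\<close> removes
      it.\<close>
    have integrand: "s * deriv g s \<ge> 0" if "s \<ge> 0" for s
    proof (cases "s = 0")
      case False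
      obtain g' where g': "\<forall>s\<in>{0..}. (g has_real_derivative g' s) (at s within {0..})"
        using C1_on_real[OF g_C1] by blast
      have "(g has_real_derivative g' s) (at s)"
        using bspec[OF g', of s] that False at_within_interior[of s "{0..}"] by simp
      hence "g differentiable at s" using real_differentiable_def by blast
      thus ?thesis using deriv_ge_0_of_mono_on[OF g_mono, of s] that False by simp
    qed simp
    \<comment> \<open>For a non-integrable integrand \<open>integral\<close> has the default value
      0, so the sign is right in that case too.\<close>
    have "integral {0..r} (\<lambda>s. s * deriv g s) \<ge> 0"
    proof (cases "(\<lambda>s. s * deriv g s) integrable_on {0..r}")
      case True
      thus ?thesis by (rule integral_nonneg) (use integrand in simp)
    qed (simp add: not_integrable_integral)
    moreover have "G' r = 1 / r\<^sup>2 * integral {0..r} (\<lambda>s. s * deriv g s)"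
      using DERIV_unique GD G_deriv r by blast
    ultimately show ?thesis by simp
  qed
  \<comment> \<open>The tangent inequalities of \<open>G\<close> at \<open>r\<close> and at
    \<open>s\<close> are added, which cancels the values of \<open>G\<close>.\<close>
  have G'_mono: "G' r \<le> G' s" if "0 < r" "r \<le> s" for r s
  proof (cases "r = s")
    case False
    have "G' r * (s - r) \<le> G s - G r" "G' s * (r - s) \<le> G r - G s"
      by (rule convex_on_imp_above_tangent[OF G_convex]; use that GD in
          \<open>auto simp: interior_open intro: has_field_derivative_at_within\<close>)+
    hence "G' r * (s - r) \<le> G' s * (s - r)" by (simp add: algebra_simps)
    thus ?thesis using False that by simp
  qed simp

  obtain L' where L': "\<And>u. (L has_real_derivative L' u) (at u)"
    using C1_on_real[OF L_C2(1)] by auto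
  have "L' = deriv L" using DERIV_imp_deriv[OF L'] by auto
  hence L'c: "continuous_on UNIV L'"
    using C1_on_real[OF L_C2(2)] by (auto intro: DERIV_continuous_on)
  obtain \<kappa> where \<kappa>: "\<kappa> > 0" "\<And>u v. \<kappa> * (u - v)\<^sup>2 \<le> (L' u - L' v) * (u - v)"
    using unif_convex_strongly_mono_deriv[OF L_unif L'] by blast

  \<comment> \<open>A vanishing spatial derivative makes \<open>V\<close> constant in space at each
    time; position 0 serves as representative.\<close>
  have V_eq: "V y s = V 0 s" if "s \<in> {0..T}" for y s
    using DERIV_isconst_all[of "\<lambda>z. V z s" y 0] V_x[OF that] by blast
  have "continuous_on (UNIV \<times> {0..T}) (\<lambda>(y, t). V y t)"
    by (rule C1_on_imp_continuous_on[OF V_C1])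
  hence "continuous_on {0..T} (\<lambda>s. case (0, s) of (y, t) \<Rightarrow> V y t)"
    by (rule continuous_on_compose2) (auto intro!: continuous_on_Pair)
  hence Vc: "continuous_on {0..T} (V 0)" by simp

  have "\<forall>i\<in>{1..N}. \<exists>v. (\<forall>s\<in>{0..T}. ((\<lambda>t. x t i) has_real_derivative v s) (at s within {0..T}))
          \<and> continuous_on {0..T} v"
    using C1_on_real[OF x_C1] by blast
  from bchoice[OF this] obtain v where deriv: "\<And>i s. i \<in> {1..N} \<Longrightarrow> s \<in> {0..T} \<Longrightarrow>
                  ((\<lambda>t. x t i) has_real_derivative v i s) (at s within {0..T})"
    and vc: "\<And>i. i \<in> {1..N} \<Longrightarrow> continuous_on {0..T} (v i)"
    by blast
  have xc: "continuous_on {0..T} (\<lambda>s. x s i)" if "i \<in> {1..N}" for i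
    using deriv[OF that] by (rule DERIV_continuous_on)
  have gc: "continuous_on {0..T} (\<lambda>s. gap N (x s) i)" if "i \<in> {1..N}" for i
    unfolding gap_cyc_pred by (intro continuous_intros xc cyc_pred_in that)

  define \<Gamma> where "\<Gamma> d = - (1 / real N / d\<^sup>2 * G' (1 / real N / d))" for d
  have \<Gamma>_mono: "\<Gamma> d \<le> \<Gamma> d'" if "0 < d" "d \<le> d'" for d d'
  proof -
    \<comment> \<open>Both factors are nonnegative and nonincreasing in the gap, hence so is their
      product.\<close>
    have "1 / real N / d'\<^sup>2 * G' (1 / real N / d') \<le> 1 / real N / d\<^sup>2 * G' (1 / real N / d)"
      using that N_pos
      by (intro mult_mono G'_nonneg G'_mono divide_left_mono power_mono) auto
    thus ?thesis by (simp add: \<Gamma>_def)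
  qed
  have \<Gamma>c: "continuous_on {0<..} \<Gamma>"
    unfolding \<Gamma>_def by (intro continuous_intros continuous_on_compose2[OF G'c]) (use N_pos in auto)
  define k where "k i t = \<Gamma> (gap N (x t) i) - \<Gamma> (gap N (x t) (cyc_succ N i))" for i t
  have EL: "((\<lambda>s. L' (v i s)) has_real_derivative k i t) (at t within {0..T})"
    if "i \<in> {1..N}" "t \<in> {0..T}" for i t
    unfolding k_def \<Gamma>_def
    by (rule euler_lagrange[OF L' L'c GD G'c V_eq Vc N_pos T_pos x_sol deriv vc x_strict that])
  have kc: "continuous_on {0..T} (k i)" if "i \<in> {1..N}" for i
    unfolding k_def
    by (intro continuous_intros continuous_on_compose2[OF \<Gamma>c] gc that cyc_succ_in)
       (use x_strict that cyc_succ_in[OF that] in auto)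

  define h where "h d = U (1 / real N / d) * d" for d
  have h_convex: "convex_on {0<..} h"
    unfolding h_def by (rule convex_on_perspective[OF U_convex]) simp
  obtain m where m: "\<And>d d'. d \<in> {0<..} \<Longrightarrow> d' \<in> {0<..} \<Longrightarrow> h d + m d * (d' - d) \<le> h d'"
    and m_mono: "mono_on {0<..} m"
    using convex_on_subgradient[OF h_convex open_greaterThan] by blast
  have hc: "continuous_on {0<..} h" by (rule convex_on_continuous[OF open_greaterThan h_convex])
  have "convex_on {0..T} (\<lambda>t. \<Sum>i=1..N. h (gap N (x t) i))"
  proof (rule convex_on_second_difference)
    show "continuous_on {0..T} (\<lambda>t. \<Sum>i=1..N. h (gap N (x t) i))"
      by (intro continuous_intros continuous_on_compose2[OF hc] gc) (use x_strict in auto)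
  next
    fix t e :: real assume t: "t \<in> {0<..<T}" and e: "e > 0"
    \<comment> \<open>The subgradients are frozen at the base time \<open>t\<close>: as
      \<open>r\<close> varies, each \<open>w i\<close> is constant, so \<open>w i * x s i\<close> is
      a rescaled trajectory.\<close>
    define w where "w i = m (gap N (x t) i) - m (gap N (x t) (cyc_succ N i))" for i
    have wk: "0 \<le> w i * k i t" if i: "i \<in> {1..N}" for i
    proof -
      have pos: "gap N (x t) i > 0" "gap N (x t) (cyc_succ N i) > 0"
        using x_strict t i cyc_succ_in[OF i] by auto
      show ?thesis
      proof (cases "gap N (x t) i \<le> gap N (x t) (cyc_succ N i)")
        case True
        thus ?thesis unfolding w_def k_def
          using pos \<Gamma>_mono mono_onD[OF m_mono] by (intro mult_nonpos_nonpos) auto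
      next
        case False
        thus ?thesis unfolding w_def k_def
          using pos \<Gamma>_mono mono_onD[OF m_mono] by (intro mult_nonneg_nonneg) auto
      qed
    qed
    \<comment> \<open>The error \<open>e\<close> is split equally among the \<open>N\<close>
      particles.\<close>
    have "\<forall>\<^sub>F r in at_right 0. \<forall>i\<in>{1..N}.
        - (e / real N) * r\<^sup>2 \<le> w i * x (t + r) i + w i * x (t - r) i - 2 * (w i * x t i)"
    proof (rule eventually_ball_finite, simp, rule ballI)
      fix i assume i: "i \<in> {1..N}"
      have e': "e / real N > 0" using e N_pos by simp
      show "\<forall>\<^sub>F r in at_right 0.
          - (e / real N) * r\<^sup>2 \<le> w i * x (t + r) i + w i * x (t - r) i - 2 * (w i * x t i)"
      proof (rule second_difference_ge[OF _ t])
        show "\<forall>\<^sub>F r in at_right 0. - 2 * (e / real N) * r \<le> w i * v i (t + r) - w i * v i (t - r)"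
          using velocity_difference_ge[OF EL[OF i] kc[OF i] t wk[OF i] \<kappa> e'] .
        show "((\<lambda>s. w i * x s i) has_real_derivative w i * v i s) (at s within {0..T})"
          if "s \<in> {0..T}" for s
          by (intro DERIV_cmult deriv i that)
      qed
    qed
    moreover have "\<forall>\<^sub>F r in at_right 0. r \<in> {0<..<min t (T - t)}"
      by (rule eventually_at_right_real) (use t in auto)
    ultimately show "\<forall>\<^sub>F r in at_right 0. - e * r\<^sup>2 \<le> (\<Sum>i=1..N. h (gap N (x (t + r)) i))
        + (\<Sum>i=1..N. h (gap N (x (t - r)) i)) - 2 * (\<Sum>i=1..N. h (gap N (x t) i))"
    proof eventually_elim
      case (elim r)
      define \<Delta> where "\<Delta> i = x (t + r) i + x (t - r) i - 2 * x t i" for i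
      have "- e * r\<^sup>2 = (\<Sum>i=1..N. - (e / real N) * r\<^sup>2)" using N_pos by simp
      also have "\<dots> \<le> (\<Sum>i=1..N. w i * \<Delta> i)"
        by (intro sum_mono) (use elim in \<open>simp add: \<Delta>_def algebra_simps\<close>)
      also have "\<dots> = (\<Sum>i=1..N. m (gap N (x t) i) * (\<Delta> i - \<Delta> (cyc_pred N i)))"
        unfolding w_def by (rule sum_cyc_by_parts[symmetric])
      \<comment> \<open>The subgradient inequality at the gap of time \<open>t\<close> is used
        towards the gaps at both \<open>t + r\<close> and \<open>t - r\<close>.\<close>
      also have "\<dots> \<le> (\<Sum>i=1..N. h (gap N (x (t + r)) i) + h (gap N (x (t - r)) i)
                          - 2 * h (gap N (x t) i))"
      proof (rule sum_mono)
        fix i assume i: "i \<in> {1..N}"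
        have pos: "gap N (x t) i > 0" "gap N (x (t + r)) i > 0" "gap N (x (t - r)) i > 0"
          using x_strict t i elim by auto
        \<comment> \<open>The periodic constant in the first gap occurs with total weight 1 + 1 - 2
          = 0.\<close>
        have \<Delta>_gap: "\<Delta> i - \<Delta> (cyc_pred N i) = (gap N (x (t + r)) i - gap N (x t) i)
                + (gap N (x (t - r)) i - gap N (x t) i)"
          by (simp add: \<Delta>_def gap_cyc_pred)
        show "m (gap N (x t) i) * (\<Delta> i - \<Delta> (cyc_pred N i))
            \<le> h (gap N (x (t + r)) i) + h (gap N (x (t - r)) i) - 2 * h (gap N (x t) i)"
          unfolding \<Delta>_gap distrib_left
          using m[of "gap N (x t) i" "gap N (x (t + r)) i"]
            m[of "gap N (x t) i" "gap N (x (t - r)) i"] pos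
          by simp
      qed
      also have "\<dots> = (\<Sum>i=1..N. h (gap N (x (t + r)) i))
        + (\<Sum>i=1..N. h (gap N (x (t - r)) i)) - 2 * (\<Sum>i=1..N. h (gap N (x t) i))"
        by (simp add: sum.distrib sum_subtractf sum_distrib_left)
      finally show ?case .
    qed
  qed
  thus ?thesis by (simp add: h_def particle_density_def)
qed

end
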